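(* Let $\mathcal{P}\subseteq2^\omega$ be a nonempty $\Pi^0_1$ class. Then $X\in2^\omega$ is a randomly produced path through $T_{\mathcal{P}}$ if and only if $X$ is $T_{\mathcal{P}}$-Martin-Löf random with respect to $\mu_{\mathcal{P}}$, i.e. $X\in\mathsf{MLR}^{T_{\mathcal{P}}}_{\mu_{\mathcal{P}}}$.
   Context: Notation: $2^\omega$ is the set of infinite binary sequences, $2^{<\omega}$ the set of finite binary strings, $\epsilon$ the empty string, $X\upharpoonright n$ the initial segment of length $n$, $[\![\sigma]\!]=\{X\in2^\omega:\sigma\prec X\}$, and $\lambda$ the Lebesgue measure on $2^\omega$. A $\Pi^0_1$ class is the set of infinite paths through a computable tree $T\subseteq2^{<\omega}$. For a closed set $\mathcal{P}$, $T_{\mathcal{P}}=\{\sigma:\mathcal{P}\cap[\![\sigma]\!]\neq\emptyset\}$. Martin-Löf randomness: for an oracle $A$ and a probability measure $\mu$ on $2^\omega$, $\mathsf{MLR}^A_\mu$ is the set of $X$ such that $X\notin\bigcap_n\mathcal{U}_n$ for every uniformly $A$-c.e. sequence of open sets $(\mathcal{U}_n)$ with $\mu(\mathcal{U}_n)\le2^{-n}$ for all $n$; $\mathsf{MLR}^A=\mathsf{MLR}^A_\lambda$. Randomly produced paths: for $R\in2^\omega$, $\Psi_{\mathcal{P}}(R)\in\mathcal{P}$ is the sequence $X$ built recursively as follows. Given $\sigma=X\upharpoonright m\in T_{\mathcal{P}}$, let $n$ be the number of bits of $R$ used so far, i.e. the number of $j<m$ such that both one-bit extensions of $X\upharpoonright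 j$ lie in $T_{\mathcal{P}}$. If only one $i\in\{0,1\}$ satisfies $\sigma i\in T_{\mathcal{P}}$, put $X(m)=i$; if both $\sigma0,\sigma1\in T_{\mathcal{P}}$, put $X(m)=R(n)$. The randomly produced paths through $T_{\mathcal{P}}$ are the members of $\{\Psi_{\mathcal{P}}(R):R\in\mathsf{MLR}^{T_{\mathcal{P}}}\}$. The measure $\mu_{\mathcal{P}}$: define $\phi:2^{<\omega}\to T_{\mathcal{P}}$ by $\phi(\epsilon)=\epsilon$ and, for each $\sigma$: if $\phi(\sigma)0$ and $\phi(\sigma)1$ are both in $T_{\mathcal{P}}$, then $\phi(\sigma i)=\phi(\sigma)i$ for $i\in\{0,1\}$; if $\phi(\sigma)i\notin T_{\mathcal{P}}$ for some $i$ (so $\phi(\sigma)(1-i)\in T_{\mathcal{P}}$), then $\phi(\sigma0)=\phi(\sigma1)=\phi(\sigma)(1-i)$. Let $\Phi_{\mathcal{P}}(X)=\bigcup_n\phi(X\upharpoonright n)$, a total $T_{\mathcal{P}}$-computable functional $2^\omega\to\mathcal{P}$. Then $\mu_{\mathcal{P}}$ is the induced measure, $\mu_{\mathcal{P}}([\![\sigma]\!])=\lambda(\{X:\sigma\prec\Phi_{\mathcal{P}}(X)\})$. *)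

theory Defs
  imports "HOL-Probability.Probability"
begin

type_synonym str = "bool list"
type_synonym cantor = "nat \<Rightarrow> bool"

definition init_seg :: "cantor \<Rightarrow> nat \<Rightarrow> str" where
  "init_seg X n = map X [0..<n]"

definition cyl :: "str \<Rightarrow> cantor set" where
  "cyl \<sigma> = {X. init_seg X (length \<sigma>) = \<sigma>}"

definition ext_strings :: "cantor set \<Rightarrow> str set" where
  "ext_strings P = {\<sigma>. P \<inter> cyl \<sigma> \<noteq> {}}"

text \<open>Strings enter computability through their numerical value in binary
  after a leading digit 1.\<close>

definition str_code :: "str \<Rightarrow> nat" where
  "str_code \<sigma> = foldl (\<lambda>k b. 2 * k + of_bool b) 1 \<sigma>"

lemma str_code_Nil [simp]: "str_code [] = 1"
  by (simp add: str_code_def)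

lemma str_code_snoc [simp]: "str_code (\<sigma> @ [b]) = 2 * str_code \<sigma> + of_bool b"
  by (simp add: str_code_def)

lemma str_code_pos: "str_code \<sigma> > 0"
  by (induction \<sigma> rule: rev_induct) auto

lemma inj_str_code: "inj str_code"
proof (rule injI)
  fix \<sigma> \<tau> :: str
  assume "str_code \<sigma> = str_code \<tau>"
  then show "\<sigma> = \<tau>"
  proof (induction \<sigma> arbitrary: \<tau> rule: rev_induct)
    case Nil
    show ?case
    proof (cases \<tau> rule: rev_cases)
      case (snoc \<tau>' c)
      then show ?thesis using Nil str_code_pos[of \<tau>'] by simp
    qed simp
  next
    case (snoc b \<sigma>)
    show ?case
    proof (cases \<tau> rule: rev_cases)
      case Nil
      then show ?thesis using snoc.prems str_code_pos[of \<sigma>] by simp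
    next
      case (snoc \<tau>' c)
      then have eq: "2 * str_code \<sigma> + of_bool b = 2 * str_code \<tau>' + of_bool c"
        using snoc.prems by simp
      have "b = c"
        using arg_cong[OF eq, of even] by (cases b; cases c) auto
      with eq snoc.IH[of \<tau>'] snoc show ?thesis by simp
    qed
  qed
qed

text \<open>Programs for the partial recursive functions relative to an oracle:
  the initial functions together with the characteristic function of the oracle,
  closed under composition, primitive recursion and (unbounded) minimization.
  The relation \<open>eval A p xs y\<close> says that \<open>p\<close>, run on the arguments \<open>xs\<close> with oracle \<open>A\<close>,
  halts with output \<open>y\<close>.\<close>

datatype prog = Zero | Succ | Proj nat | Query | Comp prog "prog list" | PrimRec prog prog | Mu prog

inductive eval :: "nat set \<Rightarrow> prog \<Rightarrow> nat list \<Rightarrow> nat \<Rightarrow> bool" for A :: "nat set" where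
  zero: "eval A Zero xs 0"
| succ: "eval A Succ [x] (Suc x)"
| proj: "i < length xs \<Longrightarrow> eval A (Proj i) xs (xs ! i)"
| query: "eval A Query [x] (of_bool (x \<in> A))"
| comp: "list_all2 (\<lambda>g y. eval A g xs y) gs ys \<Longrightarrow> eval A f ys z \<Longrightarrow> eval A (Comp f gs) xs z"
| rec_0: "eval A f xs y \<Longrightarrow> eval A (PrimRec f g) (0 # xs) y"
| rec_Suc: "eval A (PrimRec f g) (n # xs) y \<Longrightarrow> eval A g (n # y # xs) z \<Longrightarrow>
    eval A (PrimRec f g) (Suc n # xs) z"
| mu: "eval A f (n # xs) 0 \<Longrightarrow> (\<forall>m<n. \<exists>y. eval A f (m # xs) (Suc y)) \<Longrightarrow> eval A (Mu f) xs n"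

lemma eval_deterministic: "eval A p xs y \<Longrightarrow> eval A p xs z \<Longrightarrow> y = z"
proof (induction arbitrary: z rule: eval.induct)
  case (rec_0 f xs y g)
  from rec_0.prems have "eval A f xs z"
    by (cases rule: eval.cases)
  then show ?case by (rule rec_0.IH)
next
  case (rec_Suc f g n xs y w)
  from rec_Suc.prems obtain y' where "eval A (PrimRec f g) (n # xs) y'" "eval A g (n # y' # xs) z"
    by (cases rule: eval.cases)
  with rec_Suc.IH show ?case by blast
next
  case (comp xs gs ys f w)
  from comp.prems obtain ys' where
    ys': "list_all2 (\<lambda>g y. eval A g xs y) gs ys'" "eval A f ys' z"
    by (cases rule: eval.cases)
  have "ys = ys'"
    using comp.IH(1) ys'(1)
    by (auto simp: list_all2_conv_all_nth intro!: nth_equalityI)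
  with ys'(2) comp.IH(2) show ?case by simp
next
  case (mu f n xs)
  from mu.prems have z: "eval A f (z # xs) 0"
    by (cases rule: eval.cases)
  from mu.prems have z2: "\<forall>m<z. \<exists>y. eval A f (m # xs) (Suc y)"
    by (cases rule: eval.cases)
  show ?case
  proof (rule linorder_cases[of n z])
    assume "n < z"
    with z2 mu.IH(1) show ?thesis by (metis nat.distinct(1))
  next
    assume "z < n"
    with z mu.IH(2) show ?thesis by (metis nat.distinct(1))
  qed
next
  case (zero xs)
  then show ?case by (cases rule: eval.cases) simp_all
next
  case (succ x)
  then show ?case by (cases rule: eval.cases) simp_all
next
  case (proj i xs)
  from proj.prems show ?case by (cases rule: eval.cases) simp_all
next
  case (query x)
  then show ?case by (cases rule: eval.cases) simp_all
qed

definition computable_strings :: "str set \<Rightarrow> bool" where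
  "computable_strings T \<longleftrightarrow> (\<exists>p. \<forall>\<sigma>. eval {} p [str_code \<sigma>] (of_bool (\<sigma> \<in> T)))"

text \<open>An \<open>A\<close>-c.e. set is the domain of a partial \<open>A\<close>-computable function.\<close>

definition ce_in :: "nat set \<Rightarrow> (nat \<times> str) set \<Rightarrow> bool" where
  "ce_in A W \<longleftrightarrow> (\<exists>p. W = {(n, \<sigma>). \<exists>y. eval A p [n, str_code \<sigma>] y})"

definition unif_ce_open :: "nat set \<Rightarrow> (nat \<Rightarrow> cantor set) \<Rightarrow> bool" where
  "unif_ce_open A U \<longleftrightarrow> (\<exists>W. ce_in A W \<and> (\<forall>n. U n = (\<Union>\<sigma>\<in>{\<sigma>. (n, \<sigma>) \<in> W}. cyl \<sigma>)))"

definition is_tree :: "str set \<Rightarrow> bool" where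
  "is_tree T \<longleftrightarrow> (\<forall>\<sigma> \<tau>. \<sigma> @ \<tau> \<in> T \<longrightarrow> \<sigma> \<in> T)"

definition paths :: "str set \<Rightarrow> cantor set" where
  "paths T = {X. \<forall>n. init_seg X n \<in> T}"

definition Pi01_class :: "cantor set \<Rightarrow> bool" where
  "Pi01_class P \<longleftrightarrow> (\<exists>T. is_tree T \<and> computable_strings T \<and> P = paths T)"

definition tree_oracle :: "cantor set \<Rightarrow> nat set" where
  "tree_oracle P = str_code ` ext_strings P"

definition cantor_lebesgue :: "cantor measure" where
  "cantor_lebesgue = PiM UNIV (\<lambda>_. measure_pmf (bernoulli_pmf (1/2)))"

text \<open>Sets \<open>U n\<close> as below are countable unions of cylinders, hence measurable (\<open>sets_cyl\<close>), and \<open>\<mu>\<close> is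
  meant to be a probability measure on the same sigma-algebra, so \<open>measure\<close> loses nothing.\<close>

definition MLR :: "nat set \<Rightarrow> cantor measure \<Rightarrow> cantor set" where
  "MLR A \<mu> = {X. \<forall>U. unif_ce_open A U \<and> (\<forall>n. measure \<mu> (U n) \<le> 1 / 2 ^ n) \<longrightarrow> X \<notin> (\<Inter>n. U n)}"

definition branching :: "cantor set \<Rightarrow> str \<Rightarrow> bool" where
  "branching P \<sigma> \<longleftrightarrow> \<sigma> @ [False] \<in> ext_strings P \<and> \<sigma> @ [True] \<in> ext_strings P"

definition step :: "cantor set \<Rightarrow> str \<Rightarrow> bool \<Rightarrow> str" where
  "step P \<sigma> i = \<sigma> @ [if branching P \<sigma> then i else (THE j. \<sigma> @ [j] \<in> ext_strings P)]"

definition bits_used :: "cantor set \<Rightarrow> str \<Rightarrow> nat" where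
  "bits_used P \<sigma> = card {j. j < length \<sigma> \<and> branching P (take j \<sigma>)}"

primrec Psi_seg :: "cantor set \<Rightarrow> cantor \<Rightarrow> nat \<Rightarrow> str" where
  "Psi_seg P R 0 = []"
| "Psi_seg P R (Suc m) = step P (Psi_seg P R m) (R (bits_used P (Psi_seg P R m)))"

definition Psi :: "cantor set \<Rightarrow> cantor \<Rightarrow> cantor" where
  "Psi P R m = Psi_seg P R (Suc m) ! m"

definition randomly_produced_paths :: "cantor set \<Rightarrow> cantor set" where
  "randomly_produced_paths P = Psi P ` MLR (tree_oracle P) cantor_lebesgue"

lemma length_step [simp]: "length (step P \<sigma> i) = Suc (length \<sigma>)"
  by (simp add: step_def)

lemma length_Psi_seg [simp]: "length (Psi_seg P R m) = m"
  by (induction m) auto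

lemma init_seg_Suc: "init_seg X (Suc n) = init_seg X n @ [X n]"
  by (simp add: init_seg_def)

lemma init_seg_Psi: "init_seg (Psi P R) m = Psi_seg P R m"
proof (induction m)
  case (Suc m)
  then show ?case
    by (simp add: init_seg_Suc Psi_def) (simp add: step_def nth_append)
qed (simp add: init_seg_def)

definition phi :: "cantor set \<Rightarrow> str \<Rightarrow> str" where
  "phi P \<sigma> = foldl (step P) [] \<sigma>"

lemma phi_Nil [simp]: "phi P [] = []"
  by (simp add: phi_def)

lemma phi_snoc [simp]: "phi P (\<sigma> @ [i]) = step P (phi P \<sigma>) i"
  by (simp add: phi_def)

lemma length_phi [simp]: "length (phi P \<sigma>) = length \<sigma>"
  by (induction \<sigma> rule: rev_induct) auto

text \<open>Since \<open>phi\<close> preserves length, the union of the strings \<open>phi P (init_seg X n)\<close>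
  has its bit \<open>n\<close> determined by stage \<open>n + 1\<close>; see \<open>init_seg_Phi\<close>.\<close>

definition Phi :: "cantor set \<Rightarrow> cantor \<Rightarrow> cantor" where
  "Phi P X n = phi P (init_seg X (Suc n)) ! n"

text \<open>The pushforward is meaningful because \<open>Phi P\<close> is measurable (\<open>measurable_Phi\<close>);
  \<open>measure_mu_cyl\<close> gives its values on cylinders.\<close>

definition mu :: "cantor set \<Rightarrow> cantor measure" where
  "mu P = distr cantor_lebesgue cantor_lebesgue (Phi P)"

lemma length_init_seg [simp]: "length (init_seg X n) = n"
  by (simp add: init_seg_def)

lemma init_seg_Phi: "init_seg (Phi P X) n = phi P (init_seg X n)"
proof (induction n)
  case (Suc n)
  have "Phi P X n = step P (phi P (init_seg X n)) (X n) ! n"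
    by (simp add: Phi_def init_seg_Suc)
  with Suc show ?case
    by (simp add: init_seg_Suc step_def nth_append)
qed (simp add: init_seg_def)

lemma ext_strings_step:
  assumes "\<sigma> \<in> ext_strings P"
  shows "step P \<sigma> i \<in> ext_strings P"
proof -
  from assms obtain X where X: "X \<in> P" "init_seg X (length \<sigma>) = \<sigma>"
    unfolding ext_strings_def cyl_def by blast
  from X(2) have "X \<in> cyl (\<sigma> @ [X (length \<sigma>)])"
    by (simp add: cyl_def init_seg_Suc)
  with X(1) have ext: "\<sigma> @ [X (length \<sigma>)] \<in> ext_strings P"
    unfolding ext_strings_def by blast
  show ?thesis
  proof (cases "branching P \<sigma>")
    case True
    then show ?thesis by (cases i) (simp_all add: step_def branching_def)
  next
    case False
    let ?b = "X (length \<sigma>)"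
    have b: "\<sigma> @ [?b] \<in> ext_strings P" by (rule ext)
    have "\<sigma> @ [\<not> ?b] \<notin> ext_strings P"
      using False b by (cases ?b) (simp_all add: branching_def)
    then have "j = ?b" if "\<sigma> @ [j] \<in> ext_strings P" for j
      using that by (cases "j = ?b") auto
    with b have "(THE j. \<sigma> @ [j] \<in> ext_strings P) = ?b"
      by (intro the_equality)
    with b False show ?thesis by (simp add: step_def)
  qed
qed

lemma phi_in_ext_strings: "P \<noteq> {} \<Longrightarrow> phi P \<sigma> \<in> ext_strings P"
proof (induction \<sigma> rule: rev_induct)
  case Nil
  then show ?case by (auto simp: ext_strings_def cyl_def init_seg_def)
qed (simp add: ext_strings_step)

lemma space_cantor_lebesgue [simp]: "space cantor_lebesgue = UNIV"
  by (simp add: cantor_lebesgue_def space_PiM)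

lemma prob_space_cantor_lebesgue: "prob_space cantor_lebesgue"
  unfolding cantor_lebesgue_def by (intro prob_space_PiM prob_space_measure_pmf)

lemma measurable_bit [measurable]: "(\<lambda>X. X n) \<in> measurable cantor_lebesgue (count_space UNIV)"
proof -
  have "(\<lambda>X. X n) \<in> measurable cantor_lebesgue (measure_pmf (bernoulli_pmf (1/2)))"
    unfolding cantor_lebesgue_def by (rule measurable_component_singleton) simp
  then show ?thesis by simp
qed

lemma measurable_init_seg [measurable]:
  "(\<lambda>X. init_seg X n) \<in> measurable cantor_lebesgue (count_space UNIV)"
proof (induction n)
  case (Suc n)
  note [measurable] = Suc.IH
  show ?case unfolding init_seg_Suc by measurable
qed (simp add: init_seg_def)

lemma sets_cyl [measurable]: "cyl \<sigma> \<in> sets cantor_lebesgue"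
proof -
  have "(\<lambda>X. init_seg X (length \<sigma>)) -` {\<sigma>} \<inter> space cantor_lebesgue \<in> sets cantor_lebesgue"
    by (rule measurable_sets[OF measurable_init_seg]) simp
  then show ?thesis by (simp add: cyl_def vimage_def)
qed

lemma measurable_Phi [measurable]: "Phi P \<in> measurable cantor_lebesgue cantor_lebesgue"
proof -
  have "(\<lambda>X. Phi P X n) \<in> measurable cantor_lebesgue (count_space UNIV)" for n
    unfolding Phi_def
    by (rule measurable_compose[OF measurable_init_seg]) simp
  then have "(\<lambda>X. \<lambda>n\<in>UNIV. Phi P X n) \<in>
      measurable cantor_lebesgue (PiM UNIV (\<lambda>_. measure_pmf (bernoulli_pmf (1/2))))"
    by (intro measurable_restrict) simp
  then show ?thesis
    by (simp add: cantor_lebesgue_def[symmetric] restrict_UNIV)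
qed

lemma prob_space_mu: "prob_space (mu P)"
  unfolding mu_def by (rule prob_space.prob_space_distr[OF prob_space_cantor_lebesgue measurable_Phi])

lemma measure_mu_cyl: "measure (mu P) (cyl \<sigma>) = measure cantor_lebesgue {X. Phi P X \<in> cyl \<sigma>}"
  unfolding mu_def by (subst measure_distr) (auto simp: vimage_def)

end

theory Submission
  imports Defs
begin

text \<open>Reading off the bits that a string \<open>\<tau>\<close> chooses at branching nodes gives a string \<open>read_bits P \<tau>\<close>,
  and for \<open>\<tau>\<close> in the tree, \<open>Psi P R\<close> extends \<open>\<tau>\<close> iff \<open>R\<close> extends \<open>read_bits P \<tau>\<close>. Hence \<open>mu P\<close>, which
  halves exactly at branching nodes, is also the distribution of \<open>Psi P R\<close>, and Martin-Loef tests can be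
  moved in both directions: the preimage of a \<open>mu P\<close>-test under \<open>Psi P\<close> is a Lebesgue test, and a test
  capturing \<open>R\<close> yields a \<open>mu P\<close>-test capturing the path from which the bits of \<open>R\<close> are read.
  A path with only finitely many branchings determines just a finite part of \<open>R\<close>; that part
  extends to a random sequence because the nonrandom sequences form a null set. No dovetailing or
  universal machine is needed: both transfers compose an enumeration with a total computable map on strings.\<close>

section \<open>Functions computable relative to an oracle\<close>

text \<open>Arguments form one list, so that a recursion can push its counter and previous value
  onto the front. Values on lists of length other than \<open>k\<close> are unconstrained.\<close>

definition computable_fn :: "nat set \<Rightarrow> nat \<Rightarrow> (nat list \<Rightarrow> nat) \<Rightarrow> bool" where
  "computable_fn A k f \<longleftrightarrow> (\<exists>p. \<forall>xs. length xs = k \<longrightarrow> eval A p xs (f xs))"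

lemma computable_fn_cong:
  assumes "computable_fn A k f" "\<And>xs. length xs = k \<Longrightarrow> f xs = g xs"
  shows "computable_fn A k g"
  using assms unfolding computable_fn_def by force

lemma computable_fn_nth: "i < k \<Longrightarrow> computable_fn A k (\<lambda>xs. xs ! i)"
  unfolding computable_fn_def by (metis eval.proj)

lemma computable_fn_hd: "0 < k \<Longrightarrow> computable_fn A k hd"
  by (rule computable_fn_cong[OF computable_fn_nth[of 0]]) (auto simp: hd_conv_nth)

lemma computable_fn_hd_tl: "Suc 0 < k \<Longrightarrow> computable_fn A k (\<lambda>xs. hd (tl xs))"
  by (rule computable_fn_cong[OF computable_fn_nth[of 1]], simp)
    (metis One_nat_def hd_conv_nth length_greater_0_conv length_tl nth_tl zero_less_diff)

lemma computable_fn_0: "computable_fn A k (\<lambda>_. 0)"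
  unfolding computable_fn_def by (metis eval.zero)

lemma computable_fn_comp_unary:
  assumes "\<And>x. eval A p [x] (F x)" "computable_fn A k f"
  shows "computable_fn A k (\<lambda>xs. F (f xs))"
proof -
  obtain q where "\<forall>xs. length xs = k \<longrightarrow> eval A q xs (f xs)"
    using assms(2) unfolding computable_fn_def by blast
  then have "\<forall>xs. length xs = k \<longrightarrow> eval A (Comp p [q]) xs (F (f xs))"
    using assms(1) by (auto intro!: eval.comp[where ys = "[_]"])
  then show ?thesis
    unfolding computable_fn_def by blast
qed

lemma computable_fn_Suc: "computable_fn A k f \<Longrightarrow> computable_fn A k (\<lambda>xs. Suc (f xs))"
  by (rule computable_fn_comp_unary[OF eval.succ])

lemma computable_fn_oracle:
  "computable_fn A k f \<Longrightarrow> computable_fn A k (\<lambda>xs. of_bool (f xs \<in> A))"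
  by (rule computable_fn_comp_unary[OF eval.query])

lemma computable_fn_const: "computable_fn A k (\<lambda>_. c)"
  by (induction c) (auto intro: computable_fn_0 computable_fn_Suc)

text \<open>Lifts a function of the parameters past the counter and the previous value that
  \<open>PrimRec\<close> puts in front of them.\<close>

lemma computable_fn_tl_tl:
  assumes "computable_fn A k f"
  shows "computable_fn A (Suc (Suc k)) (\<lambda>xs. f (tl (tl xs)))"
proof -
  obtain q where q: "\<forall>xs. length xs = k \<longrightarrow> eval A q xs (f xs)"
    using assms unfolding computable_fn_def by blast
  have "eval A (Comp q (map (\<lambda>i. Proj (Suc (Suc i))) [0..<k])) xs (f (tl (tl xs)))"
    if "length xs = Suc (Suc k)" for xs
  proof (rule eval.comp[where ys = "tl (tl xs)"])
    show "list_all2 (\<lambda>g y. eval A g xs y) (map (\<lambda>i. Proj (Suc (Suc i))) [0..<k]) (tl (tl xs))"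
      using that eval.proj[of "Suc (Suc _)" xs A] by (auto simp: list_all2_conv_all_nth nth_tl)
    show "eval A q (tl (tl xs)) (f (tl (tl xs)))"
      using q that by simp
  qed
  then show ?thesis unfolding computable_fn_def by blast
qed

text \<open>The recursion depth may itself be computed: \<open>Comp\<close> puts \<open>n xs\<close>
  in front of all the parameters, which projections pass on unchanged.\<close>

lemma computable_fn_rec_nat:
  assumes "computable_fn A k b" "computable_fn A k n"
    and "computable_fn A (Suc (Suc k)) (\<lambda>xs. g (hd xs) (hd (tl xs)) (tl (tl xs)))"
  shows "computable_fn A k (\<lambda>xs. rec_nat (b xs) (\<lambda>m y. g m y xs) (n xs))"
proof -
  obtain pb where pb: "\<And>xs. length xs = k \<Longrightarrow> eval A pb xs (b xs)"
    using assms(1) unfolding computable_fn_def by blast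
  obtain pn where pn: "\<And>xs. length xs = k \<Longrightarrow> eval A pn xs (n xs)"
    using assms(2) unfolding computable_fn_def by blast
  obtain pg where pg: "\<And>xs. length xs = Suc (Suc k) \<Longrightarrow> eval A pg xs (g (hd xs) (hd (tl xs)) (tl (tl xs)))"
    using assms(3) unfolding computable_fn_def by blast
  have rec: "eval A (PrimRec pb pg) (m # xs) (rec_nat (b xs) (\<lambda>m y. g m y xs) m)"
    if "length xs = k" for m xs
  proof (induction m)
    case 0
    then show ?case using pb that by (auto intro: eval.rec_0)
  next
    case (Suc m)
    then show ?case using pg[of "m # _ # xs"] that by (auto intro: eval.rec_Suc)
  qed
  have "eval A (Comp (PrimRec pb pg) (pn # map Proj [0..<k])) xs
      (rec_nat (b xs) (\<lambda>m y. g m y xs) (n xs))" if "length xs = k" for xs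
  proof (rule eval.comp[where ys = "n xs # xs"])
    show "list_all2 (\<lambda>g y. eval A g xs y) (pn # map Proj [0..<k]) (n xs # xs)"
      using that eval.proj[of _ xs A] pn by (auto simp: list_all2_conv_all_nth nth_Cons')
  qed (use rec that in auto)
  then show ?thesis unfolding computable_fn_def by blast
qed

section \<open>Arithmetic by primitive recursion\<close>

lemma computable_fn_add:
  assumes "computable_fn A k f" "computable_fn A k g"
  shows "computable_fn A k (\<lambda>xs. f xs + g xs)"
proof -
  have "rec_nat a (\<lambda>_ y. Suc y) b = a + b" for a b :: nat
    by (induction b) auto
  then show ?thesis
    using computable_fn_rec_nat[OF assms, of "\<lambda>_ y _. Suc y"]
    by (simp add: computable_fn_Suc computable_fn_hd_tl)
qed

lemma computable_fn_diff:
  assumes "computable_fn A k f" "computable_fn A k g"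
  shows "computable_fn A k (\<lambda>xs. f xs - g xs)"
proof -
  have "rec_nat 0 (\<lambda>m _. m) b = b - 1" for b :: nat
    by (induction b) auto
  then have pred: "computable_fn A k (\<lambda>xs. f xs - 1)" if "computable_fn A k f" for k f
    using computable_fn_rec_nat[OF computable_fn_0 that, of "\<lambda>m _ _. m"]
    by (simp add: computable_fn_hd)
  have "rec_nat a (\<lambda>_ y. y - 1) b = a - b" for a b :: nat
    by (induction b) auto
  then show ?thesis
    using computable_fn_rec_nat[OF assms, of "\<lambda>_ y _. y - 1"] pred[OF computable_fn_hd_tl]
    by simp
qed

lemma computable_fn_if_0:
  assumes "computable_fn A k f" "computable_fn A k g" "computable_fn A k h"
  shows "computable_fn A k (\<lambda>xs. if f xs = 0 then g xs else h xs)"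
proof -
  have "rec_nat a (\<lambda>_ _. b) c = (if c = 0 then a else b)" for a b c :: nat
    by (induction c) auto
  then show ?thesis
    using computable_fn_rec_nat[OF assms(2,1), of "\<lambda>_ _ xs. h xs"]
    by (simp add: computable_fn_tl_tl assms(3))
qed

lemma computable_fn_mod_2:
  assumes "computable_fn A k f"
  shows "computable_fn A k (\<lambda>xs. f xs mod 2)"
proof -
  have "rec_nat 0 (\<lambda>_ y. 1 - y) b = b mod 2" for b :: nat
    by (induction b) (auto simp: mod_Suc)
  then show ?thesis
    using computable_fn_rec_nat[OF computable_fn_0 assms, of "\<lambda>_ y _. 1 - y"]
      computable_fn_diff[OF computable_fn_const computable_fn_hd_tl, of "Suc (Suc k)" A 1]
    by simp
qed

lemma computable_fn_div_2:
  assumes "computable_fn A k f"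
  shows "computable_fn A k (\<lambda>xs. f xs div 2)"
proof -
  \<comment> \<open>\<open>b div 2\<close> is the number of odd \<open>m < b\<close>.\<close>
  have "rec_nat 0 (\<lambda>m y. y + m mod 2) b = b div 2" for b :: nat
    by (induction b) (auto, presburger)
  then show ?thesis
    using computable_fn_rec_nat[OF computable_fn_0 assms, of "\<lambda>m y _. y + m mod 2"]
    by (simp add: computable_fn_add computable_fn_mod_2 computable_fn_hd computable_fn_hd_tl)
qed

lemma computable_fn_div_power_2:
  assumes "computable_fn A k f" "computable_fn A k g"
  shows "computable_fn A k (\<lambda>xs. f xs div 2 ^ g xs)"
proof -
  have "rec_nat a (\<lambda>_ y. y div 2) b = a div 2 ^ b" for a b :: nat
    by (induction b) (simp_all del: power_Suc add: power_Suc2 div_mult2_eq)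
  then show ?thesis
    using computable_fn_rec_nat[OF assms, of "\<lambda>_ y _. y div 2"]
    by (simp add: computable_fn_div_2 computable_fn_hd_tl)
qed

section \<open>Recursion on codes of strings\<close>

lemma length_less_str_code: "length \<sigma> < str_code \<sigma>"
  by (induction \<sigma> rule: rev_induct) auto

text \<open>Each halving deletes the last bit; when only the leading digit 1 is left, the next
  halving gives 0.\<close>

lemma str_code_div_power:
  "str_code \<sigma> div 2 ^ i = (if i \<le> length \<sigma> then str_code (take (length \<sigma> - i) \<sigma>) else 0)"
proof (induction i)
  case (Suc i)
  have "str_code \<sigma> div 2 ^ Suc i = (str_code \<sigma> div 2 ^ i) div 2"
    by (simp del: power_Suc add: power_Suc2 div_mult2_eq)
  moreover have "str_code (take (length \<sigma> - i) \<sigma>) div 2 = str_code (take (length \<sigma> - Suc i) \<sigma>)"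
    if "Suc i \<le> length \<sigma>"
    using that take_Suc_conv_app_nth[of "length \<sigma> - Suc i" \<sigma>] by (simp add: Suc_diff_Suc)
  ultimately show ?case
    using Suc by (auto simp: not_less_eq_eq le_Suc_eq)
qed simp

lemma str_code_nth:
  assumes "i < length \<sigma>"
  shows "(str_code \<sigma> div 2 ^ (length \<sigma> - Suc i)) mod 2 = of_bool (\<sigma> ! i)"
  using assms by (simp add: str_code_div_power take_Suc_conv_app_nth)

text \<open>For \<open>c = str_code \<sigma>\<close> the numbers \<open>c div 2 ^ (c - j)\<close>, \<open>j \<le> c\<close>, are \<open>0\<close> for a while and then
  run through the codes of the initial segments of \<open>\<sigma>\<close>; so the length of \<open>\<sigma>\<close> need not be known.\<close>

definition code_rec :: "nat \<Rightarrow> (nat \<Rightarrow> nat \<Rightarrow> nat) \<Rightarrow> nat \<Rightarrow> nat" where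
  "code_rec a h c =
    rec_nat a (\<lambda>j y. if c div 2 ^ (c - j) = 0 then y else h y (c div 2 ^ (c - Suc j))) c"

text \<open>Covers any recursion on the last bit. The step \<open>h\<close> receives the code of the
  extended string, whose quotient and remainder modulo 2 give the shorter string and the new
  bit.\<close>

lemma code_rec_str_code:
  assumes Nil: "f [] = a" and snoc: "\<And>\<sigma> b. f (\<sigma> @ [b]) = h (f \<sigma>) (str_code (\<sigma> @ [b]))"
  shows "code_rec a h (str_code \<sigma>) = f \<sigma>"
proof -
  let ?c = "str_code \<sigma>" and ?L = "length \<sigma>"
  have L: "?L < ?c" by (rule length_less_str_code)
  \<comment> \<open>Invariant: after \<open>j\<close> rounds the first \<open>j - (?c - ?L)\<close>
    bits are processed. Truncated subtraction makes this 0 during the idle rounds.\<close>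
  have "rec_nat a (\<lambda>j y. if ?c div 2 ^ (?c - j) = 0 then y else h y (?c div 2 ^ (?c - Suc j))) j
      = f (take (j - (?c - ?L)) \<sigma>)" if "j \<le> ?c" for j
    using that
  proof (induction j)
    case 0
    then show ?case by (simp add: Nil)
  next
    case (Suc j)
    show ?case
    proof (cases "?c - j \<le> ?L")
      case False
      then show ?thesis using Suc by (simp add: str_code_div_power)
    next
      case True
      define i where "i = j - (?c - ?L)"
      have i: "?L - (?c - j) = i" "?L - (?c - Suc j) = Suc i" "Suc j - (?c - ?L) = Suc i" "i < ?L"
        using True Suc.prems L by (auto simp: i_def)
      have "?c div 2 ^ (?c - j) \<noteq> 0"
        using True str_code_pos by (simp add: str_code_div_power)
      moreover have "?c div 2 ^ (?c - Suc j) = str_code (take (Suc i) \<sigma>)"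
        using str_code_div_power[of \<sigma> "?c - Suc j"] True i(2) by simp
      ultimately show ?thesis
        using Suc i by (simp add: i_def[symmetric] take_Suc_conv_app_nth snoc del: str_code_snoc)
    qed
  qed
  from this[of ?c] L show ?thesis by (simp add: code_rec_def)
qed

text \<open>The closure of \<open>h\<close> is assumed at every arity because the step runs inside a
  recursion, with two extra arguments.\<close>

lemma computable_fn_code_rec:
  assumes f: "computable_fn A k f"
    and h: "\<And>k f g. computable_fn A k f \<Longrightarrow> computable_fn A k g \<Longrightarrow> computable_fn A k (\<lambda>xs. h (f xs) (g xs))"
  shows "computable_fn A k (\<lambda>xs. code_rec a h (f xs))"
  unfolding code_rec_def
  by (rule computable_fn_rec_nat[OF _ f], rule computable_fn_const)
    (rule computable_fn_if_0[OF computable_fn_div_power_2[OF _ computable_fn_diff[OF _ computable_fn_hd]]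
        computable_fn_hd_tl h[OF computable_fn_hd_tl computable_fn_div_power_2[OF _
            computable_fn_diff[OF _ computable_fn_Suc[OF computable_fn_hd]]]]];
      simp add: computable_fn_tl_tl f)

text \<open>Preimages of c.e. sets under total computable maps are c.e.: first compute
  \<open>F\<close>, the action of \<open>f\<close> on codes, then run the enumerating
  program.\<close>

lemma ce_in_compose:
  assumes W: "ce_in A W"
    and f: "computable_fn A 1 (\<lambda>xs. F (hd xs))" "\<And>\<sigma>. F (str_code \<sigma>) = str_code (f \<sigma>)"
  shows "ce_in A {(n, \<sigma>). (n, f \<sigma>) \<in> W}"
proof -
  obtain p where p: "W = {(n, \<sigma>). \<exists>y. eval A p [n, str_code \<sigma>] y}"
    using W unfolding ce_in_def by blast
  have "computable_fn A 2 (\<lambda>xs. F (hd (tl xs)))"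
  proof -
    obtain q where "\<And>x. eval A q [x] (F x)"
      using f(1) unfolding computable_fn_def by (metis One_nat_def length_Cons list.sel(1) list.size(3))
    then show ?thesis
      by (rule computable_fn_comp_unary[OF _ computable_fn_hd_tl]) simp
  qed
  then obtain q where q: "eval A q [n, x] (F x)" for n x
    unfolding computable_fn_def by (metis One_nat_def Suc_1 length_Cons list.sel(1,3) list.size(3))
  have pr: "eval A (Proj 0) [n, x] n" for n x
    using eval.proj[of 0 "[n, x]" A] by simp
  have "eval A (Comp p [Proj 0, q]) [n, x] y \<longleftrightarrow> eval A p [n, F x] y" for n x y
  proof
    assume "eval A (Comp p [Proj 0, q]) [n, x] y"
    then obtain ys where "list_all2 (\<lambda>g y. eval A g [n, x] y) [Proj 0, q] ys" "eval A p ys y"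
      by (cases rule: eval.cases)
    moreover from this(1) have "ys = [n, F x]"
      using pr q eval_deterministic by (fastforce simp: list_all2_Cons1)
    ultimately show "eval A p [n, F x] y" by simp
  next
    assume "eval A p [n, F x] y"
    then show "eval A (Comp p [Proj 0, q]) [n, x] y"
      using pr q by (auto intro!: eval.comp[where ys = "[n, F x]"])
  qed
  then show ?thesis
    unfolding ce_in_def p by (intro exI[of _ "Comp p [Proj 0, q]"]) (auto simp: f(2))
qed

text \<open>The minimization ignores its search variable: it stops at once if the oracle answers 0
  and never if it answers 1.\<close>

lemma ce_in_complement_oracle: "ce_in A {(n, \<sigma>). str_code \<sigma> \<notin> A}"
proof -
  let ?q = "Comp Query [Proj 2]"
  have q: "eval A ?q [m, n, x] (of_bool (x \<in> A))" for m n x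
    using eval.proj[of 2 "[m, n, x]" A] eval.query[of A x] by (auto intro!: eval.comp[where ys = "[x]"])
  have "(\<exists>y. eval A (Mu ?q) [n, x] y) \<longleftrightarrow> x \<notin> A" for n x
  proof
    assume "\<exists>y. eval A (Mu ?q) [n, x] y"
    then obtain y where "eval A ?q [y, n, x] 0"
      by (auto elim: eval.cases)
    with q[of y n x] show "x \<notin> A"
      using eval_deterministic by fastforce
  next
    assume "x \<notin> A"
    then show "\<exists>y. eval A (Mu ?q) [n, x] y"
      using q[of 0 n x] by (intro exI[of _ 0] eval.mu) auto
  qed
  then show ?thesis
    unfolding ce_in_def by auto
qed

section \<open>Bits read along a path\<close>

lemma mem_cyl_iff: "R \<in> cyl \<sigma> \<longleftrightarrow> (\<forall>i<length \<sigma>. R i = \<sigma> ! i)"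
  unfolding cyl_def mem_Collect_eq by (subst list_eq_iff_nth_eq) (simp add: init_seg_def)

lemma mem_UN_cyl_iff: "Y \<in> (\<Union>\<sigma>\<in>B. cyl \<sigma>) \<longleftrightarrow> (\<exists>m. init_seg Y m \<in> B)"
proof
  assume "Y \<in> (\<Union>\<sigma>\<in>B. cyl \<sigma>)"
  then obtain \<sigma> where "\<sigma> \<in> B" "init_seg Y (length \<sigma>) = \<sigma>"
    by (auto simp: cyl_def)
  then show "\<exists>m. init_seg Y m \<in> B"
    by (intro exI[of _ "length \<sigma>"]) simp
next
  assume "\<exists>m. init_seg Y m \<in> B"
  then obtain m where "init_seg Y m \<in> B" ..
  moreover have "Y \<in> cyl (init_seg Y m)" by (simp add: cyl_def)
  ultimately show "Y \<in> (\<Union>\<sigma>\<in>B. cyl \<sigma>)" by blast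
qed

lemma mem_cyl_snoc: "R \<in> cyl (\<sigma> @ [b]) \<longleftrightarrow> R \<in> cyl \<sigma> \<and> R (length \<sigma>) = b"
  by (simp add: cyl_def init_seg_Suc)

lemma ext_strings_snocD: "\<tau> @ [b] \<in> ext_strings P \<Longrightarrow> \<tau> \<in> ext_strings P"
  by (auto simp: ext_strings_def mem_cyl_snoc)

lemma branching_imp_ext: "branching P \<tau> \<Longrightarrow> \<tau> @ [b] \<in> ext_strings P"
  by (cases b) (auto simp: branching_def)

text \<open>Replaces the \<open>THE\<close> in \<open>step\<close>: at a node of the tree
  \<open>step\<close> stays in the tree, so without branching it must take the only available
  extension, whatever \<open>i\<close> is.\<close>

lemma step_eq_snoc_iff:
  assumes "\<sigma> \<in> ext_strings P"
  shows "step P \<sigma> i = \<sigma> @ [b] \<longleftrightarrow> \<sigma> @ [b] \<in> ext_strings P \<and> (branching P \<sigma> \<longrightarrow> i = b)"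
proof (cases "branching P \<sigma>")
  case True
  then show ?thesis by (simp add: step_def branching_imp_ext)
next
  case False
  obtain j where j: "step P \<sigma> i = \<sigma> @ [j]"
    by (simp add: step_def)
  with ext_strings_step[OF assms, of i] have "\<sigma> @ [j] \<in> ext_strings P" by simp
  with j False show ?thesis
    by (cases b; cases j) (auto simp: branching_def)
qed

definition read_bits :: "cantor set \<Rightarrow> str \<Rightarrow> str" where
  "read_bits P \<tau> = map ((!) \<tau>) (filter (\<lambda>j. branching P (take j \<tau>)) [0..<length \<tau>])"

lemma read_bits_Nil [simp]: "read_bits P [] = []"
  by (simp add: read_bits_def)

lemma read_bits_snoc [simp]:
  "read_bits P (\<tau> @ [b]) = read_bits P \<tau> @ (if branching P \<tau> then [b] else [])"
proof -
  have "filter (\<lambda>j. branching P (take j (\<tau> @ [b]))) [0..<length \<tau>] =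
      filter (\<lambda>j. branching P (take j \<tau>)) [0..<length \<tau>]"
    by (rule filter_cong) auto
  then show ?thesis
    by (auto simp: read_bits_def nth_append)
qed

lemma length_read_bits: "length (read_bits P \<tau>) = bits_used P \<tau>"
  by (simp add: read_bits_def bits_used_def length_filter_conv_card cong: conj_cong)

lemma bits_used_le: "bits_used P \<tau> \<le> length \<tau>"
  unfolding length_read_bits[symmetric] read_bits_def
  by (metis diff_zero length_filter_le length_map length_upt)

lemma bits_used_Nil [simp]: "bits_used P [] = 0"
  by (simp flip: length_read_bits)

lemma bits_used_snoc [simp]: "bits_used P (\<tau> @ [b]) = bits_used P \<tau> + of_bool (branching P \<tau>)"
  by (simp flip: length_read_bits)

text \<open>Induction on the last bit: a forced step asks nothing of \<open>R\<close>, and a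
  branching step asks for the bit of \<open>R\<close> at position \<open>bits_used P \<tau>\<close>,
  just past the bits already read.\<close>

lemma Psi_seg_eq_iff:
  assumes "P \<noteq> {}"
  shows "Psi_seg P R (length \<tau>) = \<tau> \<longleftrightarrow> \<tau> \<in> ext_strings P \<and> R \<in> cyl (read_bits P \<tau>)"
proof (induction \<tau> rule: rev_induct)
  case Nil
  show ?case using assms by (auto simp: ext_strings_def cyl_def init_seg_def)
next
  case (snoc b \<tau>)
  have "Psi_seg P R (length (\<tau> @ [b])) = \<tau> @ [b] \<longleftrightarrow>
      Psi_seg P R (length \<tau>) = \<tau> \<and> step P \<tau> (R (bits_used P \<tau>)) = \<tau> @ [b]"
    by (auto simp: step_def)
  also have "\<dots> \<longleftrightarrow> \<tau> @ [b] \<in> ext_strings P \<and> R \<in> cyl (read_bits P (\<tau> @ [b]))"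
    unfolding snoc using ext_strings_snocD[of \<tau> b P] step_eq_snoc_iff[of \<tau> P "R (bits_used P \<tau>)" b]
    by (auto simp: mem_cyl_snoc length_read_bits)
  finally show ?case .
qed

lemma Psi_in_cyl_iff:
  assumes "P \<noteq> {}"
  shows "Psi P R \<in> cyl \<tau> \<longleftrightarrow> \<tau> \<in> ext_strings P \<and> R \<in> cyl (read_bits P \<tau>)"
  using Psi_seg_eq_iff[OF assms] by (simp add: cyl_def[of \<tau>] init_seg_Psi)

lemma Psi_seg_in_ext_strings: "P \<noteq> {} \<Longrightarrow> Psi_seg P R m \<in> ext_strings P"
  using Psi_seg_eq_iff[of P R "Psi_seg P R m"] by simp

section \<open>\<open>Psi\<close> on finite strings\<close>

lemma Psi_seg_cong:
  assumes "\<And>i. i < m \<Longrightarrow> R i = R' i"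
  shows "Psi_seg P R m = Psi_seg P R' m"
  using assms
proof (induction m)
  case (Suc m)
  have "bits_used P (Psi_seg P R' m) < Suc m"
    using bits_used_le[of P "Psi_seg P R' m"] by simp
  with Suc show ?case by simp
qed simp

text \<open>Padding with \<open>False\<close> is harmless: at most \<open>length \<sigma>\<close>
  bits are used in \<open>length \<sigma>\<close> steps, so no position beyond
  \<open>\<sigma>\<close> is read.\<close>

definition Psi_str :: "cantor set \<Rightarrow> str \<Rightarrow> str" where
  "Psi_str P \<sigma> = Psi_seg P (\<lambda>i. i < length \<sigma> \<and> \<sigma> ! i) (length \<sigma>)"

lemma length_Psi_str [simp]: "length (Psi_str P \<sigma>) = length \<sigma>"
  by (simp add: Psi_str_def)

lemma Psi_str_init_seg: "Psi_str P (init_seg R m) = Psi_seg P R m"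
  unfolding Psi_str_def length_init_seg by (rule Psi_seg_cong) (simp add: init_seg_def)

lemma Psi_str_Nil [simp]: "Psi_str P [] = []"
  by (simp add: Psi_str_def)

lemma Psi_str_snoc:
  "Psi_str P (\<sigma> @ [b]) = step P (Psi_str P \<sigma>) ((\<sigma> @ [b]) ! bits_used P (Psi_str P \<sigma>))"
proof -
  have "Psi_seg P (\<lambda>i. i < length (\<sigma> @ [b]) \<and> (\<sigma> @ [b]) ! i) (length \<sigma>) = Psi_str P \<sigma>"
    unfolding Psi_str_def by (rule Psi_seg_cong) (auto simp: nth_append)
  moreover have "bits_used P (Psi_str P \<sigma>) < length (\<sigma> @ [b])"
    using bits_used_le[of P "Psi_str P \<sigma>"] by simp
  ultimately show ?thesis by (simp add: Psi_str_def[of P "\<sigma> @ [b]"])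
qed

lemma Psi_str_in_ext_strings: "P \<noteq> {} \<Longrightarrow> Psi_str P \<sigma> \<in> ext_strings P"
  by (simp add: Psi_str_def Psi_seg_in_ext_strings)

section \<open>Computability from the tree oracle\<close>

lemma str_code_mem_tree_oracle [simp]: "str_code \<sigma> \<in> tree_oracle P \<longleftrightarrow> \<sigma> \<in> ext_strings P"
  unfolding tree_oracle_def by (rule inj_image_mem_iff[OF inj_str_code])

text \<open>\<open>c + c\<close> and \<open>Suc (c + c)\<close> are the codes of the two one-bit
  extensions.\<close>

definition branching_code :: "nat set \<Rightarrow> nat \<Rightarrow> nat" where
  "branching_code A c = (if of_bool (c + c \<in> A) = (0::nat) then 0 else of_bool (Suc (c + c) \<in> A))"

lemma branching_code: "branching_code (tree_oracle P) (str_code \<sigma>) = of_bool (branching P \<sigma>)"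
proof -
  have eq: "Suc (str_code \<sigma> + str_code \<sigma>) = str_code (\<sigma> @ [True])"
    "str_code \<sigma> + str_code \<sigma> = str_code (\<sigma> @ [False])" by simp_all
  show ?thesis
    unfolding branching_code_def branching_def eq(1) unfolding eq(2) str_code_mem_tree_oracle by simp
qed

lemma computable_fn_branching_code:
  "computable_fn A k f \<Longrightarrow> computable_fn A k (\<lambda>xs. branching_code A (f xs))"
  unfolding branching_code_def
  by (intro computable_fn_if_0 computable_fn_oracle computable_fn_add computable_fn_Suc computable_fn_const)

definition read_bits_code :: "nat set \<Rightarrow> nat \<Rightarrow> nat" where
  "read_bits_code A =
    code_rec 1 (\<lambda>y c. if branching_code A (c div 2) = 0 then y else y + y + c mod 2)"

lemma read_bits_code: "read_bits_code (tree_oracle P) (str_code \<tau>) = str_code (read_bits P \<tau>)"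
  unfolding read_bits_code_def
  by (rule code_rec_str_code) (simp_all add: branching_code)

lemma computable_fn_read_bits_code:
  "computable_fn A k f \<Longrightarrow> computable_fn A k (\<lambda>xs. read_bits_code A (f xs))"
  unfolding read_bits_code_def
  by (erule computable_fn_code_rec)
    (intro computable_fn_if_0 computable_fn_branching_code computable_fn_div_2
      computable_fn_add computable_fn_mod_2)

definition length_code :: "nat \<Rightarrow> nat" where
  "length_code = code_rec 0 (\<lambda>y c. Suc y)"

lemma length_code: "length_code (str_code \<sigma>) = length \<sigma>"
  unfolding length_code_def by (rule code_rec_str_code) simp_all

lemma computable_fn_length_code:
  "computable_fn A k f \<Longrightarrow> computable_fn A k (\<lambda>xs. length_code (f xs))"
  unfolding length_code_def by (erule computable_fn_code_rec) (rule computable_fn_Suc)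

definition bits_used_code :: "nat set \<Rightarrow> nat \<Rightarrow> nat" where
  "bits_used_code A = code_rec 0 (\<lambda>y c. y + branching_code A (c div 2))"

lemma bits_used_code: "bits_used_code (tree_oracle P) (str_code \<sigma>) = bits_used P \<sigma>"
  unfolding bits_used_code_def by (rule code_rec_str_code) (simp_all add: branching_code)

lemma computable_fn_bits_used_code:
  "computable_fn A k f \<Longrightarrow> computable_fn A k (\<lambda>xs. bits_used_code A (f xs))"
  unfolding bits_used_code_def
  by (erule computable_fn_code_rec)
    (intro computable_fn_branching_code computable_fn_div_2 computable_fn_add)

text \<open>Here \<open>y\<close> codes the path so far. A forced bit is 1 iff the extension by
  \<open>True\<close> is in the tree. A free bit may sit anywhere in the input, not only at its end,
  so it is extracted by position, counted from the right.\<close>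

definition Psi_str_code :: "nat set \<Rightarrow> nat \<Rightarrow> nat" where
  "Psi_str_code A = code_rec 1 (\<lambda>y c. y + y +
    (if branching_code A y = 0 then of_bool (Suc (y + y) \<in> A)
     else c div 2 ^ (length_code c - Suc (bits_used_code A y)) mod 2))"

lemma Psi_str_code:
  assumes "P \<noteq> {}"
  shows "Psi_str_code (tree_oracle P) (str_code \<sigma>) = str_code (Psi_str P \<sigma>)"
  unfolding Psi_str_code_def
proof (rule code_rec_str_code)
  fix \<sigma> b
  let ?\<tau> = "Psi_str P \<sigma>" and ?\<sigma> = "\<sigma> @ [b]"
  have "bits_used P ?\<tau> < length ?\<sigma>"
    using bits_used_le[of P ?\<tau>] by simp
  then have bit: "str_code ?\<sigma> div 2 ^ (length ?\<sigma> - Suc (bits_used P ?\<tau>)) mod 2 = of_bool (?\<sigma> ! bits_used P ?\<tau>)"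
    by (rule str_code_nth)
  have mem: "Suc (str_code ?\<tau> + str_code ?\<tau>) \<in> tree_oracle P \<longleftrightarrow> ?\<tau> @ [True] \<in> ext_strings P"
  proof -
    have "Suc (str_code ?\<tau> + str_code ?\<tau>) = str_code (?\<tau> @ [True])" by simp
    then show ?thesis by (simp only: str_code_mem_tree_oracle)
  qed
  obtain j where j: "step P ?\<tau> (?\<sigma> ! bits_used P ?\<tau>) = ?\<tau> @ [j]"
    by (simp add: step_def)
  then have "?\<tau> @ [j] \<in> ext_strings P \<and> (branching P ?\<tau> \<longrightarrow> (?\<sigma> ! bits_used P ?\<tau>) = j)"
    using step_eq_snoc_iff[OF Psi_str_in_ext_strings[OF assms]] by metis
  then have "of_bool j = (if branching_code (tree_oracle P) (str_code ?\<tau>) = 0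
      then of_bool (Suc (str_code ?\<tau> + str_code ?\<tau>) \<in> tree_oracle P)
      else str_code ?\<sigma> div 2 ^ (length_code (str_code ?\<sigma>) -
        Suc (bits_used_code (tree_oracle P) (str_code ?\<tau>))) mod 2)"
    unfolding bits_used_code length_code bit mem branching_code
    by (cases j) (auto simp: branching_def)
  moreover have "str_code (Psi_str P ?\<sigma>) = str_code ?\<tau> + str_code ?\<tau> + of_bool j"
    by (simp add: Psi_str_snoc j)
  ultimately show "str_code (Psi_str P ?\<sigma>) = str_code ?\<tau> + str_code ?\<tau> +
      (if branching_code (tree_oracle P) (str_code ?\<tau>) = 0
      then of_bool (Suc (str_code ?\<tau> + str_code ?\<tau>) \<in> tree_oracle P)
      else str_code ?\<sigma> div 2 ^ (length_code (str_code ?\<sigma>) -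
        Suc (bits_used_code (tree_oracle P) (str_code ?\<tau>))) mod 2)"
    by (simp only:)
qed simp

lemma computable_fn_Psi_str_code:
  "computable_fn A k f \<Longrightarrow> computable_fn A k (\<lambda>xs. Psi_str_code A (f xs))"
  unfolding Psi_str_code_def
  by (erule computable_fn_code_rec)
    (intro computable_fn_if_0 computable_fn_branching_code computable_fn_div_power_2
      computable_fn_add computable_fn_mod_2 computable_fn_diff computable_fn_Suc
      computable_fn_length_code computable_fn_bits_used_code computable_fn_oracle)

lemma ce_in_read_bits:
  assumes "ce_in (tree_oracle P) W"
  shows "ce_in (tree_oracle P) {(n, \<tau>). (n, read_bits P \<tau>) \<in> W}"
  by (rule ce_in_compose[where F = "read_bits_code (tree_oracle P)"])
    (simp_all add: assms computable_fn_read_bits_code computable_fn_hd read_bits_code)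

lemma ce_in_Psi_str:
  assumes "P \<noteq> {}" "ce_in (tree_oracle P) W"
  shows "ce_in (tree_oracle P) {(n, \<sigma>). (n, Psi_str P \<sigma>) \<in> W}"
  by (rule ce_in_compose[where F = "Psi_str_code (tree_oracle P)"])
    (simp_all add: assms computable_fn_Psi_str_code computable_fn_hd Psi_str_code)

section \<open>The induced measure\<close>

lemma measure_cyl: "measure cantor_lebesgue (cyl \<sigma>) = 1 / 2 ^ length \<sigma>"
proof -
  interpret product_prob_space "\<lambda>_::nat. measure_pmf (bernoulli_pmf (1/2))" UNIV
    by unfold_locales
  have "cyl \<sigma> = {X \<in> space cantor_lebesgue. \<forall>i\<in>{..<length \<sigma>}. X i \<in> {\<sigma> ! i}}"
    by (auto simp: mem_cyl_iff)
  then have "emeasure cantor_lebesgue (cyl \<sigma>) =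
      (\<Prod>i<length \<sigma>. emeasure (measure_pmf (bernoulli_pmf (1/2))) {\<sigma> ! i})"
    using emeasure_PiM_Collect[of "{..<length \<sigma>}" "\<lambda>i. {\<sigma> ! i}"] by (simp add: cantor_lebesgue_def)
  also have "\<dots> = (\<Prod>i<length \<sigma>. ennreal (1/2))"
    by (intro prod.cong refl) (simp add: emeasure_pmf_single pmf_bernoulli_half)
  also have "\<dots> = ennreal (1 / 2 ^ length \<sigma>)"
    unfolding prod_constant card_lessThan by (subst ennreal_power) (simp_all add: power_one_over)
  finally show ?thesis by (simp add: measure_def)
qed

section \<open>Finite measures are determined by cylinders\<close>

lemma finite_strings_length: "finite {\<sigma> :: str. length \<sigma> = m}"
  using finite_lists_length_eq[of "UNIV :: bool set" m] by simp

lemma measure_init_seg_in: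
  assumes M: "finite_measure M" "sets M = sets cantor_lebesgue" and F: "F \<subseteq> {\<sigma>. length \<sigma> = m}"
  shows "measure M {X. init_seg X m \<in> F} = (\<Sum>\<sigma>\<in>F. measure M (cyl \<sigma>))"
proof -
  interpret finite_measure M by fact
  have "{X. init_seg X m \<in> F} = (\<Union>\<sigma>\<in>F. cyl \<sigma>)"
    using F by (auto simp: cyl_def)
  moreover have "disjoint_family_on cyl F"
    using F by (auto simp: disjoint_family_on_def cyl_def) (metis (mono_tags) mem_Collect_eq subsetD)
  moreover have "finite F"
    using F finite_strings_length finite_subset by blast
  ultimately show ?thesis
    using M(2) sets_cyl by (simp add: finite_measure_finite_Union image_subset_iff)
qed

text \<open>The product sigma-algebra is generated by sets constraining finitely many coordinates;
  if these lie below \<open>m\<close>, such a set is a disjoint union of cylinders of strings of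
  length \<open>m\<close>.\<close>

lemma measure_eqI_cyl:
  assumes M: "finite_measure M" "sets M = sets cantor_lebesgue"
    and N: "finite_measure N" "sets N = sets cantor_lebesgue"
    and eq: "\<And>\<sigma>. measure M (cyl \<sigma>) = measure N (cyl \<sigma>)"
  shows "M = N"
proof (rule measure_eqI_PiM_infinite)
  let ?K = "\<lambda>_::nat. measure_pmf (bernoulli_pmf (1/2))"
  show "sets M = sets (PiM UNIV ?K)" "sets N = sets (PiM UNIV ?K)"
    using M N by (simp_all add: cantor_lebesgue_def)
  show "finite_measure M" by fact
  fix A :: "nat \<Rightarrow> bool set" and J :: "nat set"
  assume J: "finite J"
  then obtain m where m: "J \<subseteq> {..<m}"
    using finite_nat_bounded by blast
  define F where "F = {\<sigma>. length \<sigma> = m \<and> (\<forall>j\<in>J. \<sigma> ! j \<in> A j)}"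
  have "init_seg X m ! j = X j" if "j \<in> J" for X j
    using m that by (auto simp: init_seg_def)
  then have "prod_emb UNIV ?K J (Pi\<^sub>E J A) = {X. init_seg X m \<in> F}"
    by (auto simp: prod_emb_def F_def space_PiM Pi_iff)
  moreover have "measure M {X. init_seg X m \<in> F} = measure N {X. init_seg X m \<in> F}"
  proof -
    have F: "F \<subseteq> {\<sigma>. length \<sigma> = m}"
      by (auto simp: F_def)
    show ?thesis
      unfolding measure_init_seg_in[OF M F] measure_init_seg_in[OF N F] by (simp add: eq)
  qed
  ultimately show "emeasure M (prod_emb UNIV ?K J (Pi\<^sub>E J A)) = emeasure N (prod_emb UNIV ?K J (Pi\<^sub>E J A))"
    using M(1) N(1) by (simp add: finite_measure.emeasure_eq_measure)
qed

text \<open>Unlike \<open>Psi\<close>, \<open>phi\<close> consumes an input bit at forced steps too.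
  Either value is allowed there, which doubles the number of preimages; a branching step fixes the
  bit.\<close>

lemma card_phi_eq:
  assumes "P \<noteq> {}"
  shows "real (card {\<sigma>. length \<sigma> = length \<tau> \<and> phi P \<sigma> = \<tau>}) =
    (if \<tau> \<in> ext_strings P then 2 ^ length \<tau> / 2 ^ bits_used P \<tau> else 0)"
proof (induction \<tau> rule: rev_induct)
  case Nil
  have "{\<sigma>. \<sigma> = [] \<and> phi P \<sigma> = []} = {[]}" by auto
  then show ?case using assms by (auto simp: ext_strings_def cyl_def init_seg_def)
next
  case (snoc b \<tau>)
  show ?case
  proof (cases "\<tau> @ [b] \<in> ext_strings P")
    case False
    then have "phi P \<sigma> \<noteq> \<tau> @ [b]" for \<sigma>
      using phi_in_ext_strings[OF assms, of \<sigma>] by auto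
    then show ?thesis using False by simp
  next
    case True
    then have \<tau>: "\<tau> \<in> ext_strings P" by (rule ext_strings_snocD)
    let ?F = "{\<sigma>. length \<sigma> = length \<tau> \<and> phi P \<sigma> = \<tau>}" and ?I = "{i. branching P \<tau> \<longrightarrow> i = b}"
    have phi_snoc_iff: "phi P (\<sigma> @ [i]) = \<tau> @ [b] \<longleftrightarrow> phi P \<sigma> = \<tau> \<and> i \<in> ?I" for \<sigma> i
    proof -
      have "phi P (\<sigma> @ [i]) = \<tau> @ [b] \<longleftrightarrow> phi P \<sigma> = \<tau> \<and> step P \<tau> i = \<tau> @ [b]"
        by (auto simp: step_def)
      then show ?thesis using step_eq_snoc_iff[OF \<tau>] True by simp
    qed
    have "{\<sigma>. length \<sigma> = length (\<tau> @ [b]) \<and> phi P \<sigma> = \<tau> @ [b]} = (\<lambda>(\<sigma>, i). \<sigma> @ [i]) ` (?F \<times> ?I)"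
    proof (intro equalityI subsetI)
      fix \<sigma>'
      assume "\<sigma>' \<in> {\<sigma>. length \<sigma> = length (\<tau> @ [b]) \<and> phi P \<sigma> = \<tau> @ [b]}"
      moreover from this obtain \<sigma> i where "\<sigma>' = \<sigma> @ [i]"
        by (cases \<sigma>' rule: rev_cases) auto
      ultimately show "\<sigma>' \<in> (\<lambda>(\<sigma>, i). \<sigma> @ [i]) ` (?F \<times> ?I)"
        using phi_snoc_iff by (auto simp del: phi_snoc)
    qed (use phi_snoc_iff in \<open>auto simp del: phi_snoc\<close>)
    moreover have "inj_on (\<lambda>(\<sigma>, i). \<sigma> @ [i]) (?F \<times> ?I)"
      by (auto simp: inj_on_def)
    moreover have "card ?I = (if branching P \<tau> then 1 else 2)"
      by (simp add: card_UNIV_bool)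
    ultimately show ?thesis
      using snoc \<tau> True by (simp add: card_image card_cartesian_product)
  qed
qed

lemma measure_mu_cyl_eq:
  assumes "P \<noteq> {}"
  shows "measure (mu P) (cyl \<tau>) = (if \<tau> \<in> ext_strings P then 1 / 2 ^ bits_used P \<tau> else 0)"
proof -
  let ?F = "{\<sigma>. length \<sigma> = length \<tau> \<and> phi P \<sigma> = \<tau>}"
  have "{X. Phi P X \<in> cyl \<tau>} = {X. init_seg X (length \<tau>) \<in> ?F}"
    by (auto simp: cyl_def init_seg_Phi)
  moreover have "measure cantor_lebesgue {X. init_seg X (length \<tau>) \<in> ?F} = (\<Sum>\<sigma>\<in>?F. 1 / 2 ^ length \<tau>)"
    using prob_space_cantor_lebesgue
    by (subst measure_init_seg_in) (auto simp: measure_cyl prob_space.finite_measure)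
  ultimately show ?thesis
    using card_phi_eq[OF assms, of \<tau>] by (simp add: measure_mu_cyl)
qed

lemma measurable_Psi [measurable]: "Psi P \<in> measurable cantor_lebesgue cantor_lebesgue"
proof -
  have "(\<lambda>R. Psi P R n) \<in> measurable cantor_lebesgue (count_space UNIV)" for n
    unfolding Psi_def Psi_str_init_seg[symmetric]
    by (rule measurable_compose[OF measurable_init_seg]) simp
  then have "(\<lambda>R. \<lambda>n\<in>UNIV. Psi P R n) \<in>
      measurable cantor_lebesgue (PiM UNIV (\<lambda>_. measure_pmf (bernoulli_pmf (1/2))))"
    by (intro measurable_restrict) simp
  then show ?thesis
    by (simp add: cantor_lebesgue_def[symmetric] restrict_UNIV)
qed

text \<open>\<open>Phi P\<close> and \<open>Psi P\<close> differ as maps, but both give a cylinder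
  in the tree the measure 2 to the power of minus \<open>bits_used P \<tau>\<close>, and any other
  cylinder measure 0.\<close>

lemma mu_eq_distr_Psi:
  assumes "P \<noteq> {}"
  shows "mu P = distr cantor_lebesgue cantor_lebesgue (Psi P)"
proof (rule measure_eqI_cyl)
  fix \<tau>
  have "Psi P -` cyl \<tau> = (if \<tau> \<in> ext_strings P then cyl (read_bits P \<tau>) else {})"
    by (auto simp: Psi_in_cyl_iff[OF assms])
  then show "measure (mu P) (cyl \<tau>) = measure (distr cantor_lebesgue cantor_lebesgue (Psi P)) (cyl \<tau>)"
    by (simp add: measure_mu_cyl_eq[OF assms] measure_distr measure_cyl length_read_bits)
next
  show "finite_measure (mu P)" "finite_measure (distr cantor_lebesgue cantor_lebesgue (Psi P))"
    using prob_space_mu prob_space.prob_space_distr[OF prob_space_cantor_lebesgue measurable_Psi]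
    by (auto intro: prob_space.finite_measure)
qed (simp_all add: mu_def)

lemma sets_UN_cyl: "(\<Union>\<sigma>\<in>B. cyl \<sigma>) \<in> sets cantor_lebesgue"
  by (intro sets.countable_UN'') auto

lemma measure_mu_eq:
  assumes "P \<noteq> {}" "U \<in> sets cantor_lebesgue"
  shows "measure (mu P) U = measure cantor_lebesgue (Psi P -` U)"
  using assms by (simp add: mu_eq_distr_Psi measure_distr)

section \<open>Random sequences exist in every cylinder\<close>

text \<open>Countably many programs give countably many tests, so the union of the null sets they
  define is null.\<close>

instance prog :: countable
  by countable_datatype

lemma cyl_Int_MLR: "cyl \<sigma> \<inter> MLR A cantor_lebesgue \<noteq> {}"
proof
  assume empty: "cyl \<sigma> \<inter> MLR A cantor_lebesgue = {}"
  interpret prob_space cantor_lebesgue by (rule prob_space_cantor_lebesgue)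
  define U where "U p n = (\<Union>\<sigma>\<in>{\<sigma>. \<exists>y. eval A p [n, str_code \<sigma>] y}. cyl \<sigma>)" for p n
  \<comment> \<open>The programs whose enumerated sets obey the measure bounds, that is, the
    Lebesgue tests relative to \<open>A\<close>.\<close>
  define G where "G = {p. \<forall>n. prob (U p n) \<le> 1 / 2 ^ n}"
  have U_sets: "U p n \<in> events" for p n
    unfolding U_def by (rule sets_UN_cyl)
  have "(\<Inter>n. U p n) \<in> null_sets cantor_lebesgue" if "p \<in> G" for p
  proof -
    have "prob (\<Inter>n. U p n) \<le> (1 / 2) ^ n" for n
    proof -
      have "prob (\<Inter>n. U p n) \<le> prob (U p n)"
        by (rule finite_measure_mono) (auto intro: U_sets)
      also have "\<dots> \<le> 1 / 2 ^ n" using that by (simp add: G_def)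
      finally show ?thesis by (simp add: power_one_over)
    qed
    then have "prob (\<Inter>n. U p n) \<le> 0"
      by (intro LIMSEQ_le_const[OF LIMSEQ_power_zero[of "1/2::real"]]) auto
    then have "prob (\<Inter>n. U p n) = 0"
      by (simp add: measure_le_0_iff)
    then show ?thesis
      by (intro null_setsI) (auto simp: emeasure_eq_measure intro: U_sets)
  qed
  then have null: "(\<Union>p\<in>G. \<Inter>n. U p n) \<in> null_sets cantor_lebesgue"
    by (intro null_sets_UN') auto
  have "cyl \<sigma> \<subseteq> (\<Union>p\<in>G. \<Inter>n. U p n)"
  proof
    fix R
    assume "R \<in> cyl \<sigma>"
    with empty have "R \<notin> MLR A cantor_lebesgue" by auto
    then obtain V where V: "unif_ce_open A V" "\<forall>n. prob (V n) \<le> 1 / 2 ^ n" "R \<in> (\<Inter>n. V n)"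
      unfolding MLR_def by auto
    from V(1) obtain p where "V = U p"
      unfolding unif_ce_open_def ce_in_def U_def by force
    with V show "R \<in> (\<Union>p\<in>G. \<Inter>n. U p n)" by (auto simp: G_def)
  qed
  with null have "cyl \<sigma> \<in> null_sets cantor_lebesgue"
    by (rule null_sets_subset[OF _ sets_cyl])
  then have "prob (cyl \<sigma>) = 0"
    by (simp add: measure_eq_0_null_sets)
  then show False by (simp add: measure_cyl)
qed

section \<open>Transferring tests\<close>

text \<open>The first \<open>m\<close> bits of \<open>R\<close> determine those of
  \<open>Psi P R\<close> through \<open>Psi_str\<close>, so the preimage of a test is again
  uniformly c.e.; its measures are unchanged by \<open>mu_eq_distr_Psi\<close>.\<close>

lemma Psi_MLR:
  assumes P: "P \<noteq> {}" and R: "R \<in> MLR (tree_oracle P) cantor_lebesgue"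
  shows "Psi P R \<in> MLR (tree_oracle P) (mu P)"
proof (rule ccontr)
  assume "Psi P R \<notin> MLR (tree_oracle P) (mu P)"
  then obtain U where U: "unif_ce_open (tree_oracle P) U" "\<And>n. measure (mu P) (U n) \<le> 1 / 2 ^ n"
    "\<And>n. Psi P R \<in> U n"
    unfolding MLR_def by auto
  from U(1) obtain W where W: "ce_in (tree_oracle P) W" "\<And>n. U n = (\<Union>\<sigma>\<in>{\<sigma>. (n, \<sigma>) \<in> W}. cyl \<sigma>)"
    unfolding unif_ce_open_def by blast
  let ?V = "\<lambda>n. Psi P -` U n"
  have "?V n = (\<Union>\<sigma>\<in>{\<sigma>. (n, Psi_str P \<sigma>) \<in> W}. cyl \<sigma>)" for n
    unfolding W(2) set_eq_iff vimage_eq mem_UN_cyl_iff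
    by (simp add: init_seg_Psi Psi_str_init_seg)
  then have "unif_ce_open (tree_oracle P) ?V"
    unfolding unif_ce_open_def using ce_in_Psi_str[OF P W(1)] by fastforce
  moreover have "measure cantor_lebesgue (?V n) \<le> 1 / 2 ^ n" for n
    using U(2)[of n] measure_mu_eq[OF P, of "U n"] sets_UN_cyl by (simp add: W(2))
  ultimately have "R \<notin> (\<Inter>n. ?V n)"
    using R unfolding MLR_def by blast
  then show False using U(3) by simp
qed

text \<open>The sequences that leave the tree form a c.e. open set of measure 0, so repeating it for
  every \<open>n\<close> gives a test.\<close>

lemma MLR_mu_init_seg_in_ext_strings:
  assumes P: "P \<noteq> {}" and X: "X \<in> MLR (tree_oracle P) (mu P)"
  shows "init_seg X m \<in> ext_strings P"
proof (rule ccontr)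
  assume m: "init_seg X m \<notin> ext_strings P"
  define W where "W = {(n :: nat, \<sigma>). str_code \<sigma> \<notin> tree_oracle P}"
  define U where "U n = (\<Union>\<sigma>\<in>{\<sigma>. (n, \<sigma>) \<in> W}. cyl \<sigma>)" for n
  have U_iff: "Y \<in> U n \<longleftrightarrow> (\<exists>m. init_seg Y m \<notin> ext_strings P)" for Y n
    unfolding U_def mem_UN_cyl_iff by (simp add: W_def)
  have "ce_in (tree_oracle P) W"
    unfolding W_def by (rule ce_in_complement_oracle)
  then have "unif_ce_open (tree_oracle P) U"
    unfolding unif_ce_open_def U_def by blast
  moreover have "measure (mu P) (U n) \<le> 1 / 2 ^ n" for n
  proof -
    have "Psi P -` U n = {}"
      by (auto simp: U_iff init_seg_Psi Psi_seg_in_ext_strings[OF P])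
    moreover have "U n \<in> sets cantor_lebesgue"
      unfolding U_def by (rule sets_UN_cyl)
    ultimately show ?thesis by (simp add: measure_mu_eq[OF P])
  qed
  ultimately have "X \<notin> (\<Inter>n. U n)"
    using X unfolding MLR_def by blast
  with m show False by (auto simp: U_iff)
qed

lemma Psi_eqI:
  assumes "P \<noteq> {}" "\<And>m. init_seg X m \<in> ext_strings P" "\<And>m. R \<in> cyl (read_bits P (init_seg X m))"
  shows "Psi P R = X"
proof
  fix n
  have "Psi_seg P R (Suc n) = init_seg X (Suc n)"
    using Psi_seg_eq_iff[OF assms(1), of R "init_seg X (Suc n)"] assms(2,3) by simp
  then show "Psi P R n = X n"
    by (simp only: Psi_def) (simp add: init_seg_def del: upt_Suc)
qed

text \<open>The sets \<open>V n\<close> of sequences on which reading the bits meets \<open>U n\<close> pull back under \<open>Psi P\<close>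
  into \<open>U n\<close>, so a test for \<open>R\<close> becomes a test for \<open>X\<close>.\<close>

lemma MLR_of_read_bits:
  assumes P: "P \<noteq> {}" and X: "X \<in> MLR (tree_oracle P) (mu P)"
    and R: "\<And>k. \<exists>m. read_bits P (init_seg X m) = init_seg R k"
  shows "R \<in> MLR (tree_oracle P) cantor_lebesgue"
proof (rule ccontr)
  interpret prob_space cantor_lebesgue by (rule prob_space_cantor_lebesgue)
  assume "R \<notin> MLR (tree_oracle P) cantor_lebesgue"
  then obtain U where U: "unif_ce_open (tree_oracle P) U" "\<And>n. prob (U n) \<le> 1 / 2 ^ n"
    "\<And>n. R \<in> U n"
    unfolding MLR_def by auto
  from U(1) obtain W where W: "ce_in (tree_oracle P) W" "\<And>n. U n = (\<Union>\<sigma>\<in>{\<sigma>. (n, \<sigma>) \<in> W}. cyl \<sigma>)"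
    unfolding unif_ce_open_def by blast
  define V where "V n = (\<Union>\<tau>\<in>{\<tau>. (n, read_bits P \<tau>) \<in> W}. cyl \<tau>)" for n
  have "unif_ce_open (tree_oracle P) V"
    unfolding unif_ce_open_def V_def using ce_in_read_bits[OF W(1)] by fastforce
  moreover have "measure (mu P) (V n) \<le> 1 / 2 ^ n" for n
  proof -
    have "Psi P -` V n \<subseteq> U n"
    proof
      fix R'
      assume "R' \<in> Psi P -` V n"
      \<comment> \<open>By \<open>Psi_in_cyl_iff\<close>, a source producing an extension of
        \<open>\<tau>\<close> must itself extend \<open>read_bits P \<tau>\<close>, which is
        enumerated into \<open>U n\<close>.\<close>
      then obtain \<tau> where "(n, read_bits P \<tau>) \<in> W" "Psi P R' \<in> cyl \<tau>"
        by (auto simp: V_def)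
      then show "R' \<in> U n"
        unfolding W(2) Psi_in_cyl_iff[OF P] by blast
    qed
    then have "measure (mu P) (V n) \<le> prob (U n)"
      unfolding V_def using sets_UN_cyl
      by (simp add: measure_mu_eq[OF P] W(2) finite_measure_mono)
    then show ?thesis using U(2)[of n] by linarith
  qed
  moreover have "X \<in> V n" for n
  proof -
    obtain k where "(n, init_seg R k) \<in> W"
      using U(3)[of n] unfolding W(2) mem_UN_cyl_iff by blast
    moreover obtain m where "read_bits P (init_seg X m) = init_seg R k"
      using R by blast
    ultimately show ?thesis
      unfolding V_def mem_UN_cyl_iff by (intro exI[of _ m]) simp
  qed
  ultimately show False using X unfolding MLR_def by blast
qed

section \<open>Recovering a random source from a random path\<close>

lemma prefix_read_bits_init_seg:
  "m \<le> m' \<Longrightarrow> \<exists>\<rho>. read_bits P (init_seg X m') = read_bits P (init_seg X m) @ \<rho>"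
  by (induction m' rule: dec_induct) (auto simp: init_seg_Suc)

lemma cyl_append_subset: "cyl (\<sigma> @ \<rho>) \<subseteq> cyl \<sigma>"
  by (auto simp: mem_cyl_iff nth_append)

lemma MLR_mu_imp_randomly_produced:
  assumes P: "P \<noteq> {}" and X: "X \<in> MLR (tree_oracle P) (mu P)"
  shows "X \<in> randomly_produced_paths P"
proof -
  let ?r = "\<lambda>m. read_bits P (init_seg X m)"
  note ext = MLR_mu_init_seg_in_ext_strings[OF P X]
  have "\<exists>R \<in> MLR (tree_oracle P) cantor_lebesgue. \<forall>m. R \<in> cyl (?r m)"
  proof (cases "\<exists>M. \<forall>m. length (?r m) \<le> M")
    case True
    then obtain M where "\<forall>m. length (?r m) \<le> M" ..
    then obtain N where N: "length (?r m) \<le> length (?r N)" for m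
      using ex_has_greatest_nat[of "\<lambda>_. True" 0 "\<lambda>m. length (?r m)" "Suc M"] by (auto simp: less_Suc_eq_le)
    \<comment> \<open>All bits that the path ever determines are in \<open>?r N\<close>; the rest of
      the source is free and can be chosen random.\<close>
    obtain R where R: "R \<in> cyl (?r N)" "R \<in> MLR (tree_oracle P) cantor_lebesgue"
      using cyl_Int_MLR by blast
    have "R \<in> cyl (?r m)" for m
    proof (cases "m \<le> N")
      case True
      then show ?thesis
        using R(1) prefix_read_bits_init_seg cyl_append_subset by (metis subsetD)
    next
      case False
      then obtain \<rho> where "?r m = ?r N @ \<rho>"
        using prefix_read_bits_init_seg[of N m P X] by auto
      \<comment> \<open>Maximality of \<open>?r N\<close> forces \<open>\<rho>\<close> to be
        empty.\<close>
      with N[of m] R(1) show ?thesis by simp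
    qed
    with R(2) show ?thesis by blast
  next
    case False
    then have unbounded: "\<exists>m. k < length (?r m)" for k
      by (meson not_le)
    \<comment> \<open>Every length must be attained exactly, because the enumerated set of strings
      in a test need not be closed under extension. The lengths start at 0 and grow by at most
      1.\<close>
    have exact: "\<exists>m. length (?r m) = k" for k
    proof -
      obtain m where "k \<le> length (?r m)"
        using unbounded[of k] by (auto intro: less_imp_le)
      moreover have "length (?r 0) \<le> k"
        by (simp add: init_seg_def)
      moreover have "length (?r (Suc i)) \<le> Suc (length (?r i))" for i
        by (simp add: init_seg_Suc)
      ultimately show ?thesis
      proof (induction m)
        case (Suc m)
        then show ?case by (metis le_SucE le_antisym le_trans)
      qed auto
    qed
    \<comment> \<open>The union of the strings \<open>?r m\<close>. Any long enough \<open>m\<close>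
      gives the same bit, since these strings extend one another.\<close>
    define R where "R i = ?r (SOME m. i < length (?r m)) ! i" for i
    have R_nth: "R i = ?r m ! i" if "i < length (?r m)" for i m
    proof -
      let ?s = "SOME m. i < length (?r m)"
      have s: "i < length (?r ?s)"
        using unbounded[of i] by (rule someI_ex)
      show ?thesis
      proof (cases "m \<le> ?s")
        case True
        then show ?thesis
          using prefix_read_bits_init_seg[of m ?s P X] that by (auto simp: R_def nth_append)
      next
        case False
        then show ?thesis
          using prefix_read_bits_init_seg[of ?s m P X] s by (auto simp: R_def nth_append)
      qed
    qed
    then have R_cyl: "R \<in> cyl (?r m)" for m
      by (simp add: mem_cyl_iff)
    have "\<exists>m. ?r m = init_seg R k" for k
      using exact[of k] R_cyl by (auto simp: cyl_def)
    with R_cyl show ?thesis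
      using MLR_of_read_bits[OF P X] by blast
  qed
  then obtain R where R: "R \<in> MLR (tree_oracle P) cantor_lebesgue" "\<And>m. R \<in> cyl (?r m)"
    by blast
  then have "X = Psi P R"
    using Psi_eqI[OF P ext] by simp
  with R(1) show ?thesis
    unfolding randomly_produced_paths_def by blast
qed

theorem theorem3p3:
  fixes P :: "(nat \<Rightarrow> bool) set" and X :: "nat \<Rightarrow> bool"
  assumes "Pi01_class P" and "P \<noteq> {}"
  shows "X \<in> randomly_produced_paths P \<longleftrightarrow> X \<in> MLR (tree_oracle P) (mu P)"
  using MLR_mu_imp_randomly_produced[OF assms(2)] Psi_MLR[OF assms(2)]
  unfolding randomly_produced_paths_def by blast

end
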